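(* Let $(X,T)$ be a ternary self-distributive set and let $A$ be an abelian group (regarded as an abelian group heap). There is a bijective correspondence between $H^2_{\rm SD}(X,A)$ and equivalence (isomorphism) classes of extensions of $X$ by $2$-cocycles with heap coefficients in $A$.
   Context: A ternary self-distributive (TSD) set is a set $X$ with $T:X^3\to X$ satisfying $T(T(x,y,z),u,v)=T(T(x,u,v),T(y,u,v),T(z,u,v))$ for all $x,y,z,u,v\in X$. For an abelian group $A$ let, for $\xi:X\to A$ and $\eta:X^3\to A$, $\delta^1\xi(x_1,x_2,x_3)=\xi(x_1)-\xi(x_2)+\xi(x_3)-\xi(T(x_1,x_2,x_3))$, $\delta^2\eta(x_1,\dots,x_5)=\eta(x_1,x_2,x_3)+\eta(T(x_1,x_2,x_3),x_4,x_5)-\eta(x_1,x_4,x_5)+\eta(x_2,x_4,x_5)-\eta(x_3,x_4,x_5)-\eta(T(x_1,x_4,x_5),T(x_2,x_4,x_5),T(x_3,x_4,x_5))$. $Z^2_{\rm SD}(X,A)=\ker\delta^2$ is the group of $2$-cocycles, and $H^2_{\rm SD}(X,A)=\ker\delta^2/\mathrm{im}\,\delta^1$. Extensions: for $\eta\in Z^2_{\rm SD}(X,A)$, the extension $X\times_\eta A$ is the set $X\times A$ with the ternary operation $T'((x,a),(y,b),(z,c))=(T(x,y,z),a-b+c+\eta(x,y,z))$, which is TSD. A morphism of extensions $\phi:X\times_\eta A\to X\times_{\eta'}A$ is a morphism of ternary self-distributive sets (i.e. a map commuting with the ternary operations) which commutes with the projections $X\times A\to X$. An isomorphism is an invertible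 morphism of extensions; this defines an equivalence relation, and equivalence classes of extensions are the corresponding isomorphism classes.
   Formalization: Morphisms of extensions are additionally required to commute with translation by A on the fibres; without this the claim fails (X a point, A = Z/3: H² has 3 elements but there are only 2 isomorphism classes). *)

theory Defs
  imports Main "HOL-Library.Numeral_Type"
begin

section \<open>Ternary self-distributive sets and their low-degree cohomology\<close>

definition tsd :: "('x \<Rightarrow> 'x \<Rightarrow> 'x \<Rightarrow> 'x) \<Rightarrow> bool" where
  "tsd T \<longleftrightarrow> (\<forall>x y z u v. T (T x y z) u v = T (T x u v) (T y u v) (T z u v))"

definition delta1 ::
  "('x \<Rightarrow> 'x \<Rightarrow> 'x \<Rightarrow> 'x) \<Rightarrow> ('x \<Rightarrow> 'a::ab_group_add) \<Rightarrow> 'x \<Rightarrow> 'x \<Rightarrow> 'x \<Rightarrow> 'a" where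
  "delta1 T \<xi> x1 x2 x3 = \<xi> x1 - \<xi> x2 + \<xi> x3 - \<xi> (T x1 x2 x3)"

definition delta2 ::
  "('x \<Rightarrow> 'x \<Rightarrow> 'x \<Rightarrow> 'x) \<Rightarrow> ('x \<Rightarrow> 'x \<Rightarrow> 'x \<Rightarrow> 'a::ab_group_add)
     \<Rightarrow> 'x \<Rightarrow> 'x \<Rightarrow> 'x \<Rightarrow> 'x \<Rightarrow> 'x \<Rightarrow> 'a" where
  "delta2 T \<eta> x1 x2 x3 x4 x5 =
     \<eta> x1 x2 x3 + \<eta> (T x1 x2 x3) x4 x5 - \<eta> x1 x4 x5 + \<eta> x2 x4 x5 - \<eta> x3 x4 x5
       - \<eta> (T x1 x4 x5) (T x2 x4 x5) (T x3 x4 x5)"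

definition Z2 :: "('x \<Rightarrow> 'x \<Rightarrow> 'x \<Rightarrow> 'x) \<Rightarrow> ('x \<Rightarrow> 'x \<Rightarrow> 'x \<Rightarrow> 'a::ab_group_add) set" where
  "Z2 T = {\<eta>. \<forall>x1 x2 x3 x4 x5. delta2 T \<eta> x1 x2 x3 x4 x5 = 0}"

definition B2 :: "('x \<Rightarrow> 'x \<Rightarrow> 'x \<Rightarrow> 'x) \<Rightarrow> ('x \<Rightarrow> 'x \<Rightarrow> 'x \<Rightarrow> 'a::ab_group_add) set" where
  "B2 T = range (delta1 T)"

definition cohomologous ::
  "('x \<Rightarrow> 'x \<Rightarrow> 'x \<Rightarrow> 'x) \<Rightarrow> ('x \<Rightarrow> 'x \<Rightarrow> 'x \<Rightarrow> 'a::ab_group_add) rel" where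
  "cohomologous T =
     {(\<eta>, \<eta>'). \<eta> \<in> Z2 T \<and> \<eta>' \<in> Z2 T \<and> (\<lambda>x y z. \<eta> x y z - \<eta>' x y z) \<in> B2 T}"

definition H2 :: "('x \<Rightarrow> 'x \<Rightarrow> 'x \<Rightarrow> 'x) \<Rightarrow> ('x \<Rightarrow> 'x \<Rightarrow> 'x \<Rightarrow> 'a::ab_group_add) set set" where
  "H2 T = Z2 T // cohomologous T"

section \<open>Extensions by 2-cocycles with heap coefficients\<close>

text \<open>
  The underlying set of every extension is the type \<open>'x \<times> 'a\<close>, so an extension is
  represented by its ternary operation.
\<close>

definition ext_op ::
  "('x \<Rightarrow> 'x \<Rightarrow> 'x \<Rightarrow> 'x) \<Rightarrow> ('x \<Rightarrow> 'x \<Rightarrow> 'x \<Rightarrow> 'a::ab_group_add)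
     \<Rightarrow> 'x \<times> 'a \<Rightarrow> 'x \<times> 'a \<Rightarrow> 'x \<times> 'a \<Rightarrow> 'x \<times> 'a" where
  "ext_op T \<eta> = (\<lambda>(x, a) (y, b) (z, c). (T x y z, a - b + c + \<eta> x y z))"

definition extensions ::
  "('x \<Rightarrow> 'x \<Rightarrow> 'x \<Rightarrow> 'x)
     \<Rightarrow> ('x \<times> 'a \<Rightarrow> 'x \<times> 'a \<Rightarrow> 'x \<times> 'a \<Rightarrow> 'x \<times> 'a::ab_group_add) set" where
  "extensions T = ext_op T ` Z2 T"

definition tsd_hom ::
  "('e \<Rightarrow> 'e \<Rightarrow> 'e \<Rightarrow> 'e) \<Rightarrow> ('f \<Rightarrow> 'f \<Rightarrow> 'f \<Rightarrow> 'f) \<Rightarrow> ('e \<Rightarrow> 'f) \<Rightarrow> bool" where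
  "tsd_hom S S' \<phi> \<longleftrightarrow> (\<forall>p q r. \<phi> (S p q r) = S' (\<phi> p) (\<phi> q) (\<phi> r))"

definition over_base :: "('x \<times> 'a \<Rightarrow> 'x \<times> 'a) \<Rightarrow> bool" where
  "over_base \<phi> \<longleftrightarrow> fst \<circ> \<phi> = fst"

text \<open>
  The group \<open>A\<close> acts on \<open>X \<times> A\<close> by translating the fibres of the projection to \<open>X\<close>.
\<close>

definition translate :: "'a \<Rightarrow> 'x \<times> 'a \<Rightarrow> 'x \<times> 'a::ab_group_add" where
  "translate b = (\<lambda>(x, a). (x, a + b))"

definition equivariant :: "('x \<times> 'a \<Rightarrow> 'x \<times> 'a::ab_group_add) \<Rightarrow> bool" where
  "equivariant \<phi> \<longleftrightarrow> (\<forall>b. \<phi> \<circ> translate b = translate b \<circ> \<phi>)"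

text \<open>
  Besides commuting with the operations and with the projections to \<open>X\<close>, a morphism of
  extensions is required to commute with the action of \<open>A\<close>, i.e. to induce the identity
  on coefficients.  Without this the classes would be the orbits of \<open>Aut(A)\<close> on
  \<open>H\<^sup>2(X, A)\<close>: see \<open>no_bijection_without_equivariance\<close> below.
\<close>

definition ext_morphism ::
  "('x \<times> 'a \<Rightarrow> 'x \<times> 'a \<Rightarrow> 'x \<times> 'a \<Rightarrow> 'x \<times> 'a::ab_group_add)
     \<Rightarrow> ('x \<times> 'a \<Rightarrow> 'x \<times> 'a \<Rightarrow> 'x \<times> 'a \<Rightarrow> 'x \<times> 'a) \<Rightarrow> ('x \<times> 'a \<Rightarrow> 'x \<times> 'a) \<Rightarrow> bool" where
  "ext_morphism S S' \<phi> \<longleftrightarrow> tsd_hom S S' \<phi> \<and> over_base \<phi> \<and> equivariant \<phi>"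

definition ext_isomorphic ::
  "('x \<Rightarrow> 'x \<Rightarrow> 'x \<Rightarrow> 'x)
     \<Rightarrow> ('x \<times> 'a \<Rightarrow> 'x \<times> 'a \<Rightarrow> 'x \<times> 'a \<Rightarrow> 'x \<times> 'a::ab_group_add) rel" where
  "ext_isomorphic T =
     {(S, S'). S \<in> extensions T \<and> S' \<in> extensions T \<and>
        (\<exists>\<phi> \<psi>. ext_morphism S S' \<phi> \<and> ext_morphism S' S \<psi> \<and> \<psi> \<circ> \<phi> = id \<and> \<phi> \<circ> \<psi> = id)}"

definition ext_classes ::
  "('x \<Rightarrow> 'x \<Rightarrow> 'x \<Rightarrow> 'x)
     \<Rightarrow> ('x \<times> 'a \<Rightarrow> 'x \<times> 'a \<Rightarrow> 'x \<times> 'a \<Rightarrow> 'x \<times> 'a::ab_group_add) set set" where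
  "ext_classes T = extensions T // ext_isomorphic T"

section \<open>Well-definedness\<close>

lemma B2_subset_Z2:
  assumes "tsd T" shows "B2 T \<subseteq> Z2 T"
  using assms by (auto simp: B2_def Z2_def tsd_def delta1_def delta2_def algebra_simps)

lemma equiv_cohomologous: "equiv (Z2 T) (cohomologous T)"
proof (rule equivI)
  show "cohomologous T \<subseteq> Z2 T \<times> Z2 T" by (auto simp: cohomologous_def)
  have "(\<lambda>x y z. 0) = delta1 T (\<lambda>_. 0)" by (simp add: delta1_def fun_eq_iff)
  then show "refl_on (Z2 T) (cohomologous T)"
    by (auto simp: refl_on_def cohomologous_def B2_def)
  show "sym (cohomologous T)"
  proof (rule symI)
    fix \<eta> \<eta>' assume h: "(\<eta>, \<eta>') \<in> cohomologous T"
    then obtain \<xi> where \<xi>: "(\<lambda>x y z. \<eta> x y z - \<eta>' x y z) = delta1 T \<xi>"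
      by (auto simp: cohomologous_def B2_def)
    have "\<eta>' x y z - \<eta> x y z = delta1 T (\<lambda>x. - \<xi> x) x y z" for x y z
      using fun_cong[OF fun_cong[OF fun_cong[OF \<xi>, of x], of y], of z]
      by (simp add: delta1_def algebra_simps)
    then have "(\<lambda>x y z. \<eta>' x y z - \<eta> x y z) = delta1 T (\<lambda>x. - \<xi> x)" by blast
    with h show "(\<eta>', \<eta>) \<in> cohomologous T" by (auto simp: cohomologous_def B2_def)
  qed
  show "trans (cohomologous T)"
  proof (rule transI)
    fix \<eta> \<eta>' \<eta>'' assume h: "(\<eta>, \<eta>') \<in> cohomologous T" "(\<eta>', \<eta>'') \<in> cohomologous T"
    then obtain \<xi> \<xi>' where \<xi>: "(\<lambda>x y z. \<eta> x y z - \<eta>' x y z) = delta1 T \<xi>"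
      and \<xi>': "(\<lambda>x y z. \<eta>' x y z - \<eta>'' x y z) = delta1 T \<xi>'"
      by (auto simp: cohomologous_def B2_def)
    have "\<eta> x y z - \<eta>'' x y z = delta1 T (\<lambda>x. \<xi> x + \<xi>' x) x y z" for x y z
    proof -
      have "\<eta> x y z - \<eta>'' x y z = (\<eta> x y z - \<eta>' x y z) + (\<eta>' x y z - \<eta>'' x y z)"
        by simp
      also have "\<dots> = delta1 T \<xi> x y z + delta1 T \<xi>' x y z"
        using \<xi> \<xi>' by (metis (no_types, lifting))
      finally show ?thesis by (simp add: delta1_def algebra_simps)
    qed
    then have "(\<lambda>x y z. \<eta> x y z - \<eta>'' x y z) = delta1 T (\<lambda>x. \<xi> x + \<xi>' x)" by blast
    with h show "(\<eta>, \<eta>'') \<in> cohomologous T" by (auto simp: cohomologous_def B2_def)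
  qed
qed

lemma tsd_ext_op:
  assumes "tsd T" and "\<eta> \<in> Z2 T"
  shows "tsd (ext_op T \<eta>)"
  using assms by (auto simp: tsd_def Z2_def ext_op_def delta2_def algebra_simps)

lemma tsd_hom_comp: "tsd_hom S S' \<phi> \<Longrightarrow> tsd_hom S' S'' \<psi> \<Longrightarrow> tsd_hom S S'' (\<psi> \<circ> \<phi>)"
  unfolding tsd_hom_def o_apply by metis

lemma over_base_comp: "over_base \<phi> \<Longrightarrow> over_base \<psi> \<Longrightarrow> over_base (\<psi> \<circ> \<phi>)"
  unfolding over_base_def by (metis comp_assoc)

lemma equivariant_comp: "equivariant \<phi> \<Longrightarrow> equivariant \<psi> \<Longrightarrow> equivariant (\<psi> \<circ> \<phi>)"
  unfolding equivariant_def by (metis comp_assoc)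

lemma equiv_ext_isomorphic:
  fixes T :: "'a \<Rightarrow> 'a \<Rightarrow> 'a \<Rightarrow> 'a"
  shows "equiv (extensions T)
    (ext_isomorphic T :: ('a \<times> 'b \<Rightarrow> 'a \<times> 'b \<Rightarrow> 'a \<times> 'b \<Rightarrow> 'a \<times> 'b::ab_group_add) rel)"
proof (rule equivI)
  let ?E = "extensions T :: ('a \<times> 'b \<Rightarrow> 'a \<times> 'b \<Rightarrow> 'a \<times> 'b \<Rightarrow> 'a \<times> 'b) set"
  let ?R = "ext_isomorphic T :: ('a \<times> 'b \<Rightarrow> 'a \<times> 'b \<Rightarrow> 'a \<times> 'b \<Rightarrow> 'a \<times> 'b) rel"
  show "?R \<subseteq> ?E \<times> ?E"
    by (auto simp: ext_isomorphic_def)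
  have "ext_morphism S S id" for S :: "'a \<times> 'b \<Rightarrow> 'a \<times> 'b \<Rightarrow> 'a \<times> 'b \<Rightarrow> 'a \<times> 'b"
    by (simp add: ext_morphism_def tsd_hom_def over_base_def equivariant_def)
  then have "(S, S) \<in> ext_isomorphic T"
    if "S \<in> extensions T" for S :: "'a \<times> 'b \<Rightarrow> 'a \<times> 'b \<Rightarrow> 'a \<times> 'b \<Rightarrow> 'a \<times> 'b"
    using that unfolding ext_isomorphic_def by (auto intro!: exI[of _ id])
  then show "refl_on ?E ?R"
    by (simp add: refl_on_def)
  show "sym ?R"
    by (auto simp: sym_def ext_isomorphic_def)
  have comp: "ext_morphism S S'' (\<phi>' \<circ> \<phi>)"
    if "ext_morphism S S' \<phi>" "ext_morphism S' S'' \<phi>'"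
    for S S' S'' :: "'a \<times> 'b \<Rightarrow> 'a \<times> 'b \<Rightarrow> 'a \<times> 'b \<Rightarrow> 'a \<times> 'b" and \<phi> \<phi>'
    using that unfolding ext_morphism_def
    by (blast intro: tsd_hom_comp over_base_comp equivariant_comp)
  show "trans ?R"
  proof (rule transI)
    fix S S' S'' :: "'a \<times> 'b \<Rightarrow> _ \<Rightarrow> _ \<Rightarrow> 'a \<times> 'b"
    assume h: "(S, S') \<in> ext_isomorphic T" "(S', S'') \<in> ext_isomorphic T"
    then obtain \<phi> \<psi> \<phi>' \<psi>' where m: "ext_morphism S S' \<phi>" "ext_morphism S' S \<psi>"
        "ext_morphism S' S'' \<phi>'" "ext_morphism S'' S' \<psi>'"
      and i: "\<psi> \<circ> \<phi> = id" "\<phi> \<circ> \<psi> = id" "\<psi>' \<circ> \<phi>' = id" "\<phi>' \<circ> \<psi>' = id"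
      by (auto simp: ext_isomorphic_def)
    have "ext_morphism S S'' (\<phi>' \<circ> \<phi>)" "ext_morphism S'' S (\<psi> \<circ> \<psi>')"
      using comp m by blast+
    moreover have "(\<psi> \<circ> \<psi>') \<circ> (\<phi>' \<circ> \<phi>) = id" "(\<phi>' \<circ> \<phi>) \<circ> (\<psi> \<circ> \<psi>') = id"
      using i by (metis comp_assoc comp_id)+
    ultimately show "(S, S'') \<in> ext_isomorphic T"
      using h unfolding ext_isomorphic_def by blast
  qed
qed

section \<open>The role of equivariance\<close>

text \<open>
  For the one-point TSD set and \<open>A = \<int>/3\<close> (the numeral type \<open>3\<close>) every cochain is a
  cocycle and every coboundary vanishes, so \<open>H\<^sup>2\<close> has three elements.  If isomorphisms
  are only required to commute with the operations and the projections to \<open>X\<close>, then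
  negation on \<open>A\<close> identifies the extensions by the cocycles \<open>1\<close> and \<open>2\<close>, which leaves
  at most two classes.
\<close>

lemma no_bijection_without_equivariance:
  defines "T \<equiv> (\<lambda>x y z. x) :: unit \<Rightarrow> unit \<Rightarrow> unit \<Rightarrow> unit"
  defines "R \<equiv> {(S, S' :: unit \<times> 3 \<Rightarrow> unit \<times> 3 \<Rightarrow> unit \<times> 3 \<Rightarrow> unit \<times> 3). S \<in> extensions T \<and> S' \<in> extensions T \<and>
     (\<exists>\<phi> \<psi>. tsd_hom S S' \<phi> \<and> over_base \<phi> \<and> tsd_hom S' S \<psi> \<and> over_base \<psi> \<and>
            \<psi> \<circ> \<phi> = id \<and> \<phi> \<circ> \<psi> = id)}"
  shows "tsd T"
    and "\<not> (\<exists>\<Phi>. bij_betw \<Phi> (H2 T :: (unit \<Rightarrow> unit \<Rightarrow> unit \<Rightarrow> 3) set set) (extensions T // R))"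
proof -
  show "tsd T" by (simp add: tsd_def)
  define f :: "3 \<Rightarrow> unit \<Rightarrow> unit \<Rightarrow> unit \<Rightarrow> 3" where "f c = (\<lambda>_ _ _. c)" for c
  have range_f: "range f = UNIV"
  proof -
    have "g = f (g () () ())" for g by (simp add: f_def fun_eq_iff)
    then show ?thesis by (metis rangeI UNIV_eq_I)
  qed
  have inj_f: "inj f" by (rule injI) (simp add: f_def fun_eq_iff)
  have Z: "(Z2 T :: (unit \<Rightarrow> unit \<Rightarrow> unit \<Rightarrow> 3) set) = UNIV"
    by (auto simp: Z2_def delta2_def)
  have B: "(B2 T :: (unit \<Rightarrow> unit \<Rightarrow> unit \<Rightarrow> 3) set) = {\<lambda>_ _ _. 0}"
    by (auto simp: B2_def delta1_def fun_eq_iff)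
  have "(cohomologous T :: (unit \<Rightarrow> unit \<Rightarrow> unit \<Rightarrow> 3) rel) = Id"
    by (auto simp: cohomologous_def Z B fun_eq_iff)
  then have "(H2 T :: (unit \<Rightarrow> unit \<Rightarrow> unit \<Rightarrow> 3) set set) = (\<lambda>c. {f c}) ` UNIV"
    using range_f by (auto simp: H2_def Z quotient_def)
  moreover have "inj (\<lambda>c. {f c})" using inj_f by (simp add: inj_def)
  ultimately have card_H: "card (H2 T :: (unit \<Rightarrow> unit \<Rightarrow> unit \<Rightarrow> 3) set set) = 3"
    by (simp add: card_image)
  define n :: "unit \<times> 3 \<Rightarrow> unit \<times> 3" where "n = (\<lambda>(x, a). (x, - a))"
  have n: "tsd_hom (ext_op T (f c)) (ext_op T (f (- c))) n" "over_base n" "n \<circ> n = id" for c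
    by (auto simp: n_def tsd_hom_def ext_op_def f_def T_def over_base_def fun_eq_iff)
  have in_ext: "ext_op T (f c) \<in> extensions T" for c by (simp add: extensions_def Z)
  have sub: "R `` {ext_op T (f c)} \<subseteq> R `` {ext_op T (f (- c))}" for c
  proof
    fix S assume "S \<in> R `` {ext_op T (f c)}"
    then obtain \<phi> \<psi> where S: "S \<in> extensions T"
      and h: "tsd_hom (ext_op T (f c)) S \<phi>" "over_base \<phi>" "tsd_hom S (ext_op T (f c)) \<psi>"
        "over_base \<psi>" "\<psi> \<circ> \<phi> = id" "\<phi> \<circ> \<psi> = id" by (auto simp: R_def)
    have "tsd_hom (ext_op T (f (- c))) S (\<phi> \<circ> n)"
      using tsd_hom_comp[OF n(1)[of "- c"]] h(1) by simp
    moreover have "tsd_hom S (ext_op T (f (- c))) (n \<circ> \<psi>)"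
      using tsd_hom_comp[OF h(3) n(1)] .
    moreover have "over_base (\<phi> \<circ> n)" "over_base (n \<circ> \<psi>)"
      using h n(2) over_base_comp by blast+
    moreover have "(n \<circ> \<psi>) \<circ> (\<phi> \<circ> n) = id" "(\<phi> \<circ> n) \<circ> (n \<circ> \<psi>) = id"
      using h(5,6) n(3) by (metis comp_assoc comp_id)+
    ultimately show "S \<in> R `` {ext_op T (f (- c))}"
      using S in_ext unfolding R_def by blast
  qed
  have eq: "R `` {ext_op T (f (- c))} = R `` {ext_op T (f c)}" for c
    using sub[of c] sub[of "- c"] by auto
  have U: "(UNIV :: 3 set) = {0, 1, - 1}"
  proof (rule sym, rule card_subset_eq)
    show "card {0, 1, - 1 :: 3} = card (UNIV :: 3 set)" by simp
  qed auto
  have "(extensions T :: (unit \<times> 3 \<Rightarrow> _ \<Rightarrow> _ \<Rightarrow> _) set) = ext_op T ` f ` UNIV"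
    by (simp add: extensions_def Z range_f)
  also have "\<dots> = {ext_op T (f 0), ext_op T (f 1), ext_op T (f (- 1))}"
    by (simp only: U image_insert image_empty)
  finally have "(extensions T :: (unit \<times> 3 \<Rightarrow> _ \<Rightarrow> _ \<Rightarrow> _) set)
      = {ext_op T (f 0), ext_op T (f 1), ext_op T (f (- 1))}" .
  then have "extensions T // R = {R `` {ext_op T (f 0)}, R `` {ext_op T (f 1)}}"
    using eq[of 1] by (auto simp: quotient_def)
  then have "card (extensions T // R) \<le> 2" by (simp add: card_insert_if)
  then show "\<not> (\<exists>\<Phi>. bij_betw \<Phi> (H2 T :: (unit \<Rightarrow> unit \<Rightarrow> unit \<Rightarrow> 3) set set) (extensions T // R))"
    using card_H by (auto dest!: bij_betw_same_card)
qed

end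

theory Submission
  imports Defs
begin

text \<open>
  A map \<open>\<phi>\<close> over \<open>X\<close> that commutes with the translations by \<open>A\<close> is determined by its
  values on the zero section: it shears the fibres, \<open>\<phi> (x, a) = (x, a + \<xi> x)\<close>.  Both
  operations on \<open>X \<times> A\<close> are given by the heap operation \<open>a - b + c\<close> plus a cocycle, so
  when \<open>\<phi>\<close> is compared on the two sides the fibre coordinates cancel, and what remains of
  \<open>\<phi> \<circ> T\<^sub>\<eta> = T\<^sub>\<eta>\<^sub>' \<circ> \<phi>\<close> is the cochain equation \<open>\<eta> - \<eta>' = \<delta>\<^sup>1 \<xi>\<close> (\<open>tsd_hom_shear_iff\<close>).  A
  shear is inverted by the shear along \<open>- \<xi>\<close>, hence every morphism of extensions is an
  isomorphism, and two extensions are isomorphic exactly if their cocycles are cohomologous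
  (\<open>ext_isomorphic_iff_cohomologous\<close>).

  Thus \<open>\<eta> \<mapsto> X \<times>\<^sub>\<eta> A\<close> maps the cocycles onto the extensions and both preserves and reflects
  the equivalence relations.  Any such map descends to a bijection between the quotients
  (\<open>bij_betw_quotient_image\<close>).
\<close>

definition shear :: "('x \<Rightarrow> 'a) \<Rightarrow> 'x \<times> 'a \<Rightarrow> 'x \<times> 'a::ab_group_add" where
  "shear \<xi> = (\<lambda>(x, a). (x, a + \<xi> x))"

lemma over_base_shear: "over_base (shear \<xi>)"
  by (auto simp: over_base_def shear_def)

lemma equivariant_shear: "equivariant (shear \<xi>)"
  by (auto simp: equivariant_def shear_def translate_def algebra_simps)

lemma shear_uminus_comp: "shear (\<lambda>x. - \<xi> x) \<circ> shear \<xi> = id"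
  by (auto simp: shear_def)

lemma shear_comp_uminus: "shear \<xi> \<circ> shear (\<lambda>x. - \<xi> x) = id"
  by (auto simp: shear_def)

text \<open>
  The fibre over \<open>x\<close> is the orbit of \<open>(x, 0)\<close>, so equivariance propagates the value of
  \<open>\<phi>\<close> at \<open>(x, 0)\<close> to the whole fibre.
\<close>

lemma over_base_equivariant_imp_shear:
  assumes "over_base \<phi>" and "equivariant \<phi>"
  shows "\<phi> = shear (\<lambda>x. snd (\<phi> (x, 0)))"
proof
  fix p :: "'a \<times> 'b"
  obtain x a where p: "p = (x, a)" by (cases p)
  have zero: "\<phi> (x, 0) = (x, snd (\<phi> (x, 0)))"
    using fun_cong[OF assms(1)[unfolded over_base_def], of "(x, 0)"] by (simp add: prod_eq_iff)
  have "\<phi> (translate a (x, 0)) = translate a (\<phi> (x, 0))"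
    using assms(2) unfolding equivariant_def by (metis comp_apply)
  also have "\<dots> = (x, snd (\<phi> (x, 0)) + a)"
    by (subst zero) (simp add: translate_def)
  finally show "\<phi> p = shear (\<lambda>x. snd (\<phi> (x, 0))) p"
    by (simp add: p translate_def shear_def add.commute)
qed

text \<open>
  At \<open>((x, a), (y, b), (z, c))\<close> the two sides of the homomorphism law have the fibre
  coordinates \<open>a - b + c + \<eta> x y z + \<xi> (T x y z)\<close> and
  \<open>a - b + c + \<xi> x - \<xi> y + \<xi> z + \<eta>' x y z\<close>; the heap terms cancel, so the law says nothing
  beyond its instance on the zero section.
\<close>

lemma tsd_hom_shear_iff:
  "tsd_hom (ext_op T \<eta>) (ext_op T \<eta>') (shear \<xi>)
     \<longleftrightarrow> (\<lambda>x y z. \<eta> x y z - \<eta>' x y z) = delta1 T \<xi>"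
proof
  assume hom: "tsd_hom (ext_op T \<eta>) (ext_op T \<eta>') (shear \<xi>)"
  have "\<eta> x y z - \<eta>' x y z = delta1 T \<xi> x y z" for x y z
  proof -
    have "shear \<xi> (ext_op T \<eta> (x, 0) (y, 0) (z, 0))
        = ext_op T \<eta>' (shear \<xi> (x, 0)) (shear \<xi> (y, 0)) (shear \<xi> (z, 0))"
      using hom by (simp add: tsd_hom_def)
    then have "\<eta> x y z + \<xi> (T x y z) = \<xi> x - \<xi> y + \<xi> z + \<eta>' x y z"
      by (simp add: shear_def ext_op_def)
    then show ?thesis
      by (simp add: delta1_def algebra_simps)
  qed
  then show "(\<lambda>x y z. \<eta> x y z - \<eta>' x y z) = delta1 T \<xi>" by blast
next
  assume eq: "(\<lambda>x y z. \<eta> x y z - \<eta>' x y z) = delta1 T \<xi>"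
  have "\<eta> x y z = \<eta>' x y z + delta1 T \<xi> x y z" for x y z
    using fun_cong[OF fun_cong[OF fun_cong[OF eq, of x], of y], of z]
    by (simp add: algebra_simps)
  then show "tsd_hom (ext_op T \<eta>) (ext_op T \<eta>') (shear \<xi>)"
    by (auto simp: tsd_hom_def shear_def ext_op_def delta1_def algebra_simps)
qed

lemma ext_morphism_shear_iff:
  "ext_morphism (ext_op T \<eta>) (ext_op T \<eta>') (shear \<xi>)
     \<longleftrightarrow> (\<lambda>x y z. \<eta> x y z - \<eta>' x y z) = delta1 T \<xi>"
  by (simp add: ext_morphism_def over_base_shear equivariant_shear tsd_hom_shear_iff)

text \<open>
  Every morphism is a shear along some \<open>\<xi>\<close>, and the shears that are morphisms are the
  primitives of \<open>\<eta> - \<eta>'\<close>.  Conversely, if \<open>\<xi>\<close> is a primitive of \<open>\<eta> - \<eta>'\<close>, then \<open>- \<xi>\<close> is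
  one of \<open>\<eta>' - \<eta>\<close>, which makes the inverse shear a morphism as well.
\<close>

lemma ext_isomorphic_iff_cohomologous:
  assumes "\<eta> \<in> Z2 T" and "\<eta>' \<in> Z2 T"
  shows "(ext_op T \<eta>, ext_op T \<eta>') \<in> ext_isomorphic T \<longleftrightarrow> (\<eta>, \<eta>') \<in> cohomologous T"
proof
  assume "(ext_op T \<eta>, ext_op T \<eta>') \<in> ext_isomorphic T"
  then obtain \<phi> where \<phi>: "ext_morphism (ext_op T \<eta>) (ext_op T \<eta>') \<phi>"
    by (auto simp: ext_isomorphic_def)
  then obtain \<xi> where "\<phi> = shear \<xi>"
    using over_base_equivariant_imp_shear unfolding ext_morphism_def by blast
  with \<phi> have "(\<lambda>x y z. \<eta> x y z - \<eta>' x y z) = delta1 T \<xi>"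
    by (simp add: ext_morphism_shear_iff)
  then show "(\<eta>, \<eta>') \<in> cohomologous T"
    using assms by (auto simp: cohomologous_def B2_def)
next
  assume "(\<eta>, \<eta>') \<in> cohomologous T"
  then obtain \<xi> where \<xi>: "(\<lambda>x y z. \<eta> x y z - \<eta>' x y z) = delta1 T \<xi>"
    by (auto simp: cohomologous_def B2_def)
  have "\<eta>' x y z - \<eta> x y z = delta1 T (\<lambda>x. - \<xi> x) x y z" for x y z
    using fun_cong[OF fun_cong[OF fun_cong[OF \<xi>, of x], of y], of z]
    by (simp add: delta1_def algebra_simps)
  then have "(\<lambda>x y z. \<eta>' x y z - \<eta> x y z) = delta1 T (\<lambda>x. - \<xi> x)" by blast
  with \<xi> have "ext_morphism (ext_op T \<eta>) (ext_op T \<eta>') (shear \<xi>)"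
    and "ext_morphism (ext_op T \<eta>') (ext_op T \<eta>) (shear (\<lambda>x. - \<xi> x))"
    by (simp_all add: ext_morphism_shear_iff)
  moreover have "ext_op T \<eta> \<in> extensions T" "ext_op T \<eta>' \<in> extensions T"
    using assms by (auto simp: extensions_def)
  ultimately show "(ext_op T \<eta>, ext_op T \<eta>') \<in> ext_isomorphic T"
    using shear_uminus_comp shear_comp_uminus unfolding ext_isomorphic_def by blast
qed

text \<open>
  The induced map on quotients is written as \<open>C \<mapsto> s `` (f ` C)\<close>, which involves no choice
  of a representative; on a class of \<open>r\<close> all the \<open>f x\<close> lie in one class of \<open>s\<close>, because
  \<open>f\<close> preserves the relations.
\<close>

lemma Image_image_equiv_class:
  assumes r: "equiv A r" and s: "equiv B s"
    and rel: "\<And>x y. x \<in> A \<Longrightarrow> y \<in> A \<Longrightarrow> (f x, f y) \<in> s \<longleftrightarrow> (x, y) \<in> r"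
    and a: "a \<in> A"
  shows "s `` (f ` (r `` {a})) = s `` {f a}"
proof -
  have "s `` {f x} = s `` {f a}" if "x \<in> r `` {a}" for x
  proof -
    from that have "(a, x) \<in> r" by simp
    moreover from this have "x \<in> A" using equivE[OF r] by blast
    ultimately have "(f a, f x) \<in> s" using rel a by simp
    then show ?thesis using equiv_class_eq[OF s] by blast
  qed
  moreover have "a \<in> r `` {a}" using equiv_class_self[OF r a] .
  ultimately show ?thesis by blast
qed

lemma bij_betw_quotient_image:
  assumes r: "equiv A r" and s: "equiv B s" and surj: "f ` A = B"
    and rel: "\<And>x y. x \<in> A \<Longrightarrow> y \<in> A \<Longrightarrow> (f x, f y) \<in> s \<longleftrightarrow> (x, y) \<in> r"
  shows "bij_betw (\<lambda>C. s `` (f ` C)) (A // r) (B // s)"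
proof (rule bij_betw_imageI)
  note descend = Image_image_equiv_class[OF r s rel]
  show "inj_on (\<lambda>C. s `` (f ` C)) (A // r)"
  proof (rule inj_onI)
    fix C D
    assume C: "C \<in> A // r" and D: "D \<in> A // r" and eq: "s `` (f ` C) = s `` (f ` D)"
    from C obtain a where a: "a \<in> A" "C = r `` {a}" by (rule quotientE)
    from D obtain b where b: "b \<in> A" "D = r `` {b}" by (rule quotientE)
    have "s `` {f a} = s `` {f b}"
      using eq descend a b by simp
    then have "(f a, f b) \<in> s"
      using eq_equiv_class[OF _ s] surj b(1) by blast
    then have "(a, b) \<in> r"
      using rel a(1) b(1) by simp
    then show "C = D"
      using equiv_class_eq[OF r] a b by simp
  qed
  show "(\<lambda>C. s `` (f ` C)) ` (A // r) = B // s"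
  proof -
    have "(\<lambda>C. s `` (f ` C)) ` (A // r) = (\<lambda>a. s `` (f ` (r `` {a}))) ` A"
      by (auto simp: quotient_def)
    also have "\<dots> = (\<lambda>a. s `` {f a}) ` A"
      using descend by (rule image_cong[OF refl])
    also have "\<dots> = B // s"
      unfolding surj[symmetric] by (auto simp: quotient_def)
    finally show ?thesis .
  qed
qed

theorem proposition5p7:
  fixes T :: "'x \<Rightarrow> 'x \<Rightarrow> 'x \<Rightarrow> 'x"
  assumes "tsd T"
  shows "\<exists>\<Phi>. bij_betw \<Phi>
            (H2 T :: ('x \<Rightarrow> 'x \<Rightarrow> 'x \<Rightarrow> 'a::ab_group_add) set set)
            (ext_classes T :: ('x \<times> 'a \<Rightarrow> 'x \<times> 'a \<Rightarrow> 'x \<times> 'a \<Rightarrow> 'x \<times> 'a) set set)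
          \<and> (\<forall>\<eta>\<in>Z2 T. \<Phi> (cohomologous T `` {\<eta>}) = ext_isomorphic T `` {ext_op T \<eta>})"
proof (intro exI conjI ballI)
  show "bij_betw (\<lambda>C. ext_isomorphic T `` (ext_op T ` C))
          (H2 T :: ('x \<Rightarrow> 'x \<Rightarrow> 'x \<Rightarrow> 'a) set set) (ext_classes T)"
    unfolding H2_def ext_classes_def
    using bij_betw_quotient_image[OF equiv_cohomologous equiv_ext_isomorphic
        extensions_def[symmetric]] ext_isomorphic_iff_cohomologous
    by blast
  show "ext_isomorphic T `` (ext_op T ` (cohomologous T `` {\<eta>})) = ext_isomorphic T `` {ext_op T \<eta>}"
    if "\<eta> \<in> Z2 T" for \<eta> :: "'x \<Rightarrow> 'x \<Rightarrow> 'x \<Rightarrow> 'a"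
    using Image_image_equiv_class[OF equiv_cohomologous equiv_ext_isomorphic _ that]
      ext_isomorphic_iff_cohomologous by blast
qed

end
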